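(* Let $1\le\ell_1\le k_1$ and $1\le \ell_2\le k_2$ be integers, let $0<p\le 1$, $q=1-p$, and put $a(p)=q^{\ell_1}p^{\ell_2}$, $\ell=\ell_1+\ell_2$, $m_1=k_1-\ell_1+1$, $m_2=k_2-\ell_2+1$. Let $H^n_{\ell_1,k_1,\ell_2,k_2}$ be the number of occurrences, in $n$ independent Bernoulli($p$) trials, of at least $\ell_1$ and at most $k_1$ consecutive 0's followed by at least $\ell_2$ and at most $k_2$ consecutive 1's. Put $f(n,u,w,r,v)=n-u\ell-w(\ell+m_1)-r(\ell+m_2)-v(\ell+m_1+m_2)$ and define, for integers $n\ge0$, $m\ge0$, $$\varphi_n(t)=\sum_{u=0}^{\lfloor \frac{n}{\ell}\rfloor}\sum_{w=0}^{\lfloor\frac{n-u\ell}{\ell+m_1}\rfloor}\sum_{r=0}^{\lfloor\frac{f(n,u,w,0,0)}{\ell+m_2}\rfloor}\sum_{v=0}^{\lfloor\frac{f(n,u,w,r,0)}{\ell+m_1+m_2}\rfloor}(-1)^{w+r}\binom{f(n,u,w,r,v)+u+v+r+w}{f(n,u,w,r,v),u,w,r,v}q^{(v+w)m_1}p^{(v+r)m_2}(a(p)(t-1))^{u+w+r+v},$$ $$\kappa_{m,n}=\sum_{u=0}^{\lfloor \frac{n}{\ell}\rfloor}\sum_{w=0}^{\lfloor\frac{n-u\ell}{\ell+m_1}\rfloor}\sum_{r=0}^{\lfloor\frac{f(n,u,w,0,0)}{\ell+m_2}\rfloor}\sum_{v=0}^{\lfloor\frac{f(n,u,w,r,0)}{\ell+m_1+m_2}\rfloor}(-1)^{u+v-m}\binom{f(n,u,w,r,v)+u+v+r+w}{f(n,u,w,r,v),u,w,r,v}\binom{u+w+r+v}{m}q^{(v+w)m_1}p^{(v+r)m_2}a(p)^{u+w+r+v},$$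 and $\varphi_n(t)=0$ for $n<0$, $\kappa_{m,n}=0$ if $n<0$ or $m<0$. Then, for $n\ge\ell+1$, the probability generating function $\phi_n(t)$ and the probability mass function $p_{m,n}$ ($m\ge0$) of $H^n_{\ell_1,k_1,\ell_2,k_2}$ are given by (i) $\displaystyle \phi_n(t)=\varphi_n(t)-a(p)(t-1)\left[\sum_{i=\ell}^{\ell+m_2-1}p^{i-\ell}\varphi_{n-i}(t)-\left(\frac qp\right)^{m_1}\sum_{i=\ell+m_1}^{\ell+m_1+m_2-1}p^{i-\ell}\varphi_{n-i}(t)\right]$; (ii) $\displaystyle p_{m,n}=\kappa_{m,n}-a(p)\left[\sum_{i=\ell}^{\ell+m_2-1}p^{i-\ell}(\kappa_{m-1,n-i}-\kappa_{m,n-i})-\left(\frac qp\right)^{m_1}\sum_{i=\ell+m_1}^{\ell+m_1+m_2-1}p^{i-\ell}(\kappa_{m-1,n-i}-\kappa_{m,n-i})\right]$.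
   Context: Let $\zeta_1,\zeta_2,\dots$ be independent with $P(\zeta_i=1)=p$ and $P(\zeta_i=0)=q=1-p$. $H^n_{\ell_1,k_1,\ell_2,k_2}$ is the number of occurrences of the following pattern within $\zeta_1,\dots,\zeta_n$: a maximal block of consecutive 0's (i.e. one starting at position 1 or immediately preceded by a 1, and ended by a 1) of length $j$ with $\ell_1\le j\le k_1$, immediately followed by exactly $i$ consecutive 1's for some $\ell_2\le i\le k_2$, immediately followed by a 0, where this terminating 0 is at a position $\le n$. (The pattern is counted only when the terminating 0 occurs, so a final block of 1's not yet ended by a 0 within the first $n$ trials is not counted; the terminating 0 may be the first 0 of the next pattern.) For example, for the sequence 00111101100010100011 of length 20, $H^{20}_{1,1,1,1}=1$, $H^{20}_{1,2,2,2}=1$, $H^{20}_{1,1,1,2}=2$, $H^{20}_{1,2,1,2}=2$. $\phi_n(t)=E\big[t^{H^n_{\ell_1,k_1,\ell_2,k_2}}\big]$ and $p_{m,n}=P(H^n_{\ell_1,k_1,\ell_2,k_2}=m)$. The multinomial coefficient is $\binom{N}{u_1,\dots,u_s}=\frac{N!}{u_1!\cdots u_s!}$ and $\binom{N}{m}=0$ if $m>N$. Convention $0^0=1$. *)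

theory Defs
  imports "HOL-Probability.Probability"
begin

text \<open>A block of exactly \<open>j\<close> zeros occupying positions \<open>s, \<dots>, s + j - 1\<close> that is maximal (it begins at
  position 1 or right after a 1), then exactly \<open>i\<close> ones, then a 0 at position \<open>s + j + i\<close>.
  Trials are numbered from 1; the value \<open>x 0\<close> is never inspected.\<close>

definition zeros_ones_at :: "(nat \<Rightarrow> nat) \<Rightarrow> nat \<Rightarrow> nat \<Rightarrow> nat \<Rightarrow> bool" where
  "zeros_ones_at x s j i \<longleftrightarrow>
     s \<ge> 1 \<and> (s = 1 \<or> x (s - 1) = 1) \<and>
     (\<forall>h\<in>{s..<s + j}. x h = 0) \<and>
     (\<forall>h\<in>{s + j..<s + j + i}. x h = 1) \<and>
     x (s + j + i) = 0"

text \<open>The pattern counts only once its terminating 0 has occurred, hence \<open>s + j + i \<le> n\<close>.\<close>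

definition num_patterns :: "nat \<Rightarrow> nat \<Rightarrow> nat \<Rightarrow> nat \<Rightarrow> (nat \<Rightarrow> nat) \<Rightarrow> nat \<Rightarrow> nat" where
  "num_patterns l1 k1 l2 k2 x n =
     card {(s, j, i). j \<in> {l1..k1} \<and> i \<in> {l2..k2} \<and> s + j + i \<le> n \<and> zeros_ones_at x s j i}"

definition multinomial :: "nat \<Rightarrow> nat list \<Rightarrow> real" where
  "multinomial N us = fact N / (\<Prod>u\<leftarrow>us. fact u)"

definition fpar :: "nat \<Rightarrow> nat \<Rightarrow> nat \<Rightarrow> int \<Rightarrow> nat \<Rightarrow> nat \<Rightarrow> nat \<Rightarrow> nat \<Rightarrow> int" where
  "fpar l m1 m2 n u w r v =
     n - int (u * l) - int (w * (l + m1)) - int (r * (l + m2)) - int (v * (l + m1 + m2))"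

text \<open>In \<open>varphi\<close> and \<open>kappa\<close> below, \<open>div\<close> on integers is the floor of the quotient, and throughout the
  summation ranges \<open>fpar\<close> is nonnegative, so that \<open>nat\<close> loses nothing.\<close>

definition varphi :: "nat \<Rightarrow> nat \<Rightarrow> nat \<Rightarrow> real \<Rightarrow> real \<Rightarrow> real \<Rightarrow> int \<Rightarrow> real \<Rightarrow> real" where
  "varphi l m1 m2 p q a n t =
     (if n < 0 then 0 else
      \<Sum>u = 0..nat (n div int l).
      \<Sum>w = 0..nat ((n - int (u * l)) div int (l + m1)).
      \<Sum>r = 0..nat (fpar l m1 m2 n u w 0 0 div int (l + m2)).
      \<Sum>v = 0..nat (fpar l m1 m2 n u w r 0 div int (l + m1 + m2)).
        (let f = nat (fpar l m1 m2 n u w r v) in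
          (-1) ^ (w + r) * multinomial (f + u + v + r + w) [f, u, w, r, v]
          * q ^ ((v + w) * m1) * p ^ ((v + r) * m2) * (a * (t - 1)) ^ (u + w + r + v)))"

text \<open>The exponent \<open>u + v - m\<close> may be negative, hence \<open>powi\<close>.\<close>

definition kappa :: "nat \<Rightarrow> nat \<Rightarrow> nat \<Rightarrow> real \<Rightarrow> real \<Rightarrow> real \<Rightarrow> int \<Rightarrow> int \<Rightarrow> real" where
  "kappa l m1 m2 p q a m n =
     (if n < 0 \<or> m < 0 then 0 else
      \<Sum>u = 0..nat (n div int l).
      \<Sum>w = 0..nat ((n - int (u * l)) div int (l + m1)).
      \<Sum>r = 0..nat (fpar l m1 m2 n u w 0 0 div int (l + m2)).
      \<Sum>v = 0..nat (fpar l m1 m2 n u w r 0 div int (l + m1 + m2)).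
        (let f = nat (fpar l m1 m2 n u w r v) in
          (-1) powi (int u + int v - m) * multinomial (f + u + v + r + w) [f, u, w, r, v]
          * real ((u + w + r + v) choose nat m)
          * q ^ ((v + w) * m1) * p ^ ((v + r) * m2) * a ^ (u + w + r + v)))"

end

theory Submission
  imports Defs
begin

text \<open>Let \<open>F\<^sub>n\<close> be the mean of \<open>t\<close> to the number of patterns completed in \<open>n\<close> trials and \<open>E\<^sub>n\<close> the same
  mean when a further trial is appended that is forced to be 0. Conditioning on the last trial gives
  \<open>F\<^sub>n\<^sub>+\<^sub>1 = p F\<^sub>n + q E\<^sub>n\<close>. The forced 0 completes at most one pattern, determined by the last block
  of \<open>j\<close> zeros and \<open>i\<close> ones, and after deleting that block the word may be closed by a 0 again, whence
  \<open>E\<^sub>n = F\<^sub>n + (t - 1) (\<Sum>j i. q^j p^i (E\<^sub>n\<^sub>-\<^sub>i\<^sub>-\<^sub>j - q E\<^sub>n\<^sub>-\<^sub>i\<^sub>-\<^sub>j\<^sub>-\<^sub>1))\<close>, the subtracted term removing the words in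
  which the block of zeros is not maximal. For the generating functions in \<open>X\<close> these two relations give
  \<open>E = 1 / (1 - X - a (t - 1) X^l (1 - (q X)^m1) (1 - (p X)^m2))\<close>. Expanding the denominator into
  five monomials turns this into the multinomial sum \<open>varphi\<close>, and solving the second relation for \<open>F\<close>
  is claim (i). Claim (ii) compares the coefficients of the powers of \<open>t\<close>.\<close>

section \<open>Trials as words, and the pattern count organised by completing zeros\<close>

primrec history :: "(nat \<Rightarrow> 'a) \<Rightarrow> nat \<Rightarrow> 'a list" where
  "history x 0 = []"
| "history x (Suc n) = x (Suc n) # history x n"

lemma length_history [simp]: "length (history x n) = n"
  by (induction n) auto

lemma history_eq_iff:
  "history x n = w \<longleftrightarrow> length w = n \<and> (\<forall>h\<in>{1..n}. x h = w ! (n - h))"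
proof (induction n arbitrary: w)
  case (Suc n)
  show ?case
  proof (cases w)
    case (Cons b v)
    have "(\<forall>h\<in>{1..Suc n}. x h = (b # v) ! (Suc n - h)) \<longleftrightarrow>
          x (Suc n) = b \<and> (\<forall>h\<in>{1..n}. x h = v ! (n - h))"
      by (auto simp: atLeastAtMostSuc_conv Suc_diff_le)
    then show ?thesis using Suc[of v] Cons by auto
  qed simp
qed auto

lemma history_eq_replicate_append:
  "history x n = replicate k b @ w \<longleftrightarrow> k \<le> n \<and> w = history x (n - k) \<and> (\<forall>h\<in>{n - k<..n}. x h = b)"
proof (induction k arbitrary: n)
  case (Suc k)
  show ?case
  proof (cases n)
    case (Suc n')
    have "{n' - k<..Suc n'} = insert (Suc n') {n' - k<..n'}"
      by auto
    then show ?thesis using Suc Suc.IH[of n'] by auto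
  qed simp
qed auto

text \<open>A word lists its letters latest first, as \<open>history\<close> does: \<open>pattern_before w j i\<close> says that
  appending a 0 to the trials \<open>w\<close> completes a pattern with \<open>j\<close> zeros and \<open>i\<close> ones.\<close>

definition block_start :: "nat list \<Rightarrow> bool" where
  "block_start w \<longleftrightarrow> w = [] \<or> hd w = 1"

definition pattern_before :: "nat list \<Rightarrow> nat \<Rightarrow> nat \<Rightarrow> bool" where
  "pattern_before w j i \<longleftrightarrow> (\<exists>v. w = replicate i 1 @ replicate j 0 @ v \<and> block_start v)"

definition new_patterns :: "nat set \<Rightarrow> nat set \<Rightarrow> nat list \<Rightarrow> nat" where
  "new_patterns J I w = card {(j, i). j \<in> J \<and> i \<in> I \<and> pattern_before w j i}"

primrec count_patterns :: "nat set \<Rightarrow> nat set \<Rightarrow> nat list \<Rightarrow> nat" where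
  "count_patterns J I [] = 0"
| "count_patterns J I (b # w) =
     count_patterns J I w + (if b = 0 then new_patterns J I w else 0)"

text \<open>With trial \<open>Suc n\<close> as the closing 0, the latest-first word shows
  \<open>i\<close> ones, then \<open>j\<close> zeros, then either nothing (the block starts at
  position 1) or a 1. The start \<open>s\<close> is forced by \<open>j\<close>, \<open>i\<close> and
  \<open>n\<close>.\<close>

lemma zeros_ones_at_iff_pattern_before:
  "zeros_ones_at x s j i \<and> s + j + i = Suc n \<longleftrightarrow>
     x (Suc n) = 0 \<and> pattern_before (history x n) j i \<and> s = Suc n - j - i" (is "?L \<longleftrightarrow> ?R")
proof -
  have start: "block_start (history x k) \<longleftrightarrow> k = 0 \<or> x k = 1" for k
    by (cases k) (auto simp: block_start_def)
  have pb: "pattern_before (history x n) j i \<longleftrightarrow> i \<le> n \<and> j \<le> n - i \<and> (\<forall>h\<in>{n - i<..n}. x h = 1) \<and>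
     (\<forall>h\<in>{n - i - j<..n - i}. x h = 0) \<and> (n - i - j = 0 \<or> x (n - i - j) = 1)"
    \<comment> \<open>Stripping the ones leaves an equation with the history on the right, hence the
      second, flipped form of the rule for stripping the zeros.\<close>
    unfolding pattern_before_def history_eq_replicate_append history_eq_replicate_append[THEN eq_commute[THEN trans]]
    by (auto simp: start)
  show ?thesis
  proof (cases "i + j \<le> n \<and> s = Suc n - j - i")
    case True
    then have "{s..<s + j} = {n - i - j<..n - i}" "{s + j..<s + j + i} = {n - i<..n}"
      "s - 1 = n - i - j" "s + j + i = Suc n" "s \<ge> 1" "s = 1 \<longleftrightarrow> n - i - j = 0"
      by auto
    then show ?thesis unfolding zeros_ones_at_def pb using True by auto
  next
    case False
    then show ?thesis unfolding zeros_ones_at_def pb by auto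
  qed
qed

lemma finite_zeros_ones_at:
  assumes "finite J" "finite I"
  shows "finite {(s, j, i). j \<in> J \<and> i \<in> I \<and> s + j + i \<le> n \<and> zeros_ones_at x s j i}"
  by (rule finite_subset[of _ "{..n} \<times> J \<times> I"]) (use assms in auto)

text \<open>Each pattern is attributed to the trial of its terminating 0, so the sets of patterns
  completed by trial \<open>n\<close> grow by disjoint increments.\<close>

lemma num_patterns_eq_count_patterns:
  assumes "1 \<le> l1"
  shows "num_patterns l1 k1 l2 k2 x n = count_patterns {l1..k1} {l2..k2} (history x n)"
proof -
  define S where "S n = {(s, j, i). j \<in> {l1..k1} \<and> i \<in> {l2..k2} \<and> s + j + i \<le> n \<and> zeros_ones_at x s j i}" for n
  define T where "T n = {(s, j, i). j \<in> {l1..k1} \<and> i \<in> {l2..k2} \<and> s + j + i = Suc n \<and> zeros_ones_at x s j i}" for n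
  have fin: "finite (S n)" for n
    unfolding S_def by (rule finite_zeros_ones_at) auto
  have S_Suc: "S (Suc n) = S n \<union> T n" "S n \<inter> T n = {}" for n
    unfolding S_def T_def by auto
  have cardT: "card (T n) = (if x (Suc n) = 0 then new_patterns {l1..k1} {l2..k2} (history x n) else 0)" for n
  proof -
    have T: "T n = {(s, j, i). j \<in> {l1..k1} \<and> i \<in> {l2..k2} \<and>
        x (Suc n) = 0 \<and> pattern_before (history x n) j i \<and> s = Suc n - j - i}"
      unfolding T_def using zeros_ones_at_iff_pattern_before[of x _ _ _ n] by blast
    show ?thesis
    proof (cases "x (Suc n) = 0")
      case True
      \<comment> \<open>Since \<open>s\<close> is determined by \<open>j\<close>, \<open>i\<close>
        and \<open>n\<close>, dropping it is injective.\<close>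
      have "bij_betw snd (T n)
          {(j, i). j \<in> {l1..k1} \<and> i \<in> {l2..k2} \<and> pattern_before (history x n) j i}"
        unfolding T using True by (auto simp: bij_betw_def inj_on_def image_iff)
      then show ?thesis using True by (simp add: bij_betw_same_card new_patterns_def)
    next
      case False
      then have "T n = {}" by (auto simp: T)
      then show ?thesis using False by simp
    qed
  qed
  have "card (S n) = count_patterns {l1..k1} {l2..k2} (history x n)"
  proof (induction n)
    case 0
    have "S 0 = {}" using assms by (auto simp: S_def)
    then show ?case by simp
  next
    case (Suc n)
    have "card (S (Suc n)) = card (S n) + card (T n)"
      using S_Suc[of n] fin[of "Suc n"] by (simp add: card_Un_disjoint)
    then show ?case using Suc cardT by simp
  qed
  then show ?thesis by (simp add: num_patterns_def S_def)
qed

lemma replicate_append_unique: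
  assumes "replicate i b @ u = replicate i' b @ u'"
    and "u = [] \<or> hd u \<noteq> b" "u' = [] \<or> hd u' \<noteq> b"
  shows "i = i' \<and> u = u'"
proof -
  have tw: "takeWhile (\<lambda>x. x = b) u = []" if "u = [] \<or> hd u \<noteq> b" for u
    using that by (cases u) auto
  have "takeWhile (\<lambda>x. x = b) (replicate i b @ u) = replicate i b" if "u = [] \<or> hd u \<noteq> b" for i u
    using tw[OF that] by (subst takeWhile_append2) auto
  then have "replicate i b = replicate i' b" using assms by metis
  then have "i = i'" by (metis length_replicate)
  with assms show ?thesis by simp
qed

text \<open>Both run lengths can be read off the word: as \<open>j \<ge> 1\<close>, a 0 ends the run
  of ones, and \<open>block_start\<close> ends the run of zeros.\<close>

lemma pattern_before_unique:
  assumes "pattern_before w j i" "pattern_before w j' i'" "1 \<le> j" "1 \<le> j'"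
  shows "j = j' \<and> i = i'"
proof -
  obtain v v' where v: "w = replicate i 1 @ replicate j 0 @ v" "block_start v"
    "w = replicate i' 1 @ replicate j' 0 @ v'" "block_start v'"
    using assms(1,2) unfolding pattern_before_def by blast
  have "hd (replicate j 0 @ v) = 0" "hd (replicate j' 0 @ v') = 0"
    using assms(3,4) by (cases j; cases j'; simp)+
  then have "i = i' \<and> replicate j 0 @ v = replicate j' 0 @ v'"
    using v by (intro replicate_append_unique[of _ 1]) auto
  moreover from this have "j = j' \<and> v = v'"
    using v by (intro replicate_append_unique[of _ 0]) (auto simp: block_start_def)
  ultimately show ?thesis by simp
qed

lemma new_patterns_eq_sum:
  assumes "finite J" "finite I"
  shows "real (new_patterns J I w) = (\<Sum>j\<in>J. \<Sum>i\<in>I. of_bool (pattern_before w j i))"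
proof -
  have "{(j, i). j \<in> J \<and> i \<in> I \<and> pattern_before w j i} =
        (J \<times> I) \<inter> {z. pattern_before w (fst z) (snd z)}"
    by auto
  then show ?thesis unfolding new_patterns_def
    using assms by (simp add: sum.cartesian_product case_prod_unfold sum_of_bool_eq flip: sum_of_bool_eq)
qed

text \<open>This follows from uniqueness of the pattern that a closing 0 completes. It makes
  \<open>t ^ new_patterns J I w\<close> affine in \<open>new_patterns J I w\<close>.\<close>

lemma new_patterns_le_1:
  assumes "\<And>j. j \<in> J \<Longrightarrow> 1 \<le> j"
  shows "new_patterns J I w \<le> 1"
proof -
  have "x = y" if "x \<in> {(j, i). j \<in> J \<and> i \<in> I \<and> pattern_before w j i}"
     "y \<in> {(j, i). j \<in> J \<and> i \<in> I \<and> pattern_before w j i}" for x y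
    using that assms pattern_before_unique by (fastforce)
  then show ?thesis unfolding new_patterns_def
    by (metis (no_types, lifting) card_le_Suc0_iff_eq card.infinite One_nat_def zero_le)
qed

lemma new_patterns_0_Cons:
  assumes "\<And>i. i \<in> I \<Longrightarrow> 1 \<le> i"
  shows "new_patterns J I (0 # w) = 0"
proof -
  have "\<not> pattern_before (0 # w) j i" if "i \<in> I" for j i
    using assms[OF that] by (cases i) (auto simp: pattern_before_def)
  then show ?thesis by (auto simp: new_patterns_def intro!: card_eq_0_iff[THEN iffD2])
qed

text \<open>Ones complete nothing, and a 0 after a 0 completes nothing because a pattern needs a 1
  right before its closing 0. Only the earliest of the \<open>j\<close> zeros can matter, so the
  block acts as a single closing 0 after \<open>v\<close>.\<close>

lemma count_patterns_replicate:
  assumes "\<And>i. i \<in> I \<Longrightarrow> 1 \<le> i" "1 \<le> j"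
  shows "count_patterns J I (replicate i 1 @ replicate j 0 @ v) = count_patterns J I (0 # v)"
proof -
  have "count_patterns J I (replicate i 1 @ u) = count_patterns J I u" for u
    by (induction i) auto
  moreover have "count_patterns J I (replicate (Suc k) 0 @ v) = count_patterns J I (0 # v)" for k
    by (induction k) (use new_patterns_0_Cons[of I J] assms(1) in auto)
  ultimately show ?thesis using assms(2) by (cases j) auto
qed

section \<open>Means over random words and the recurrence for a forced closing 0\<close>

primrec mean :: "real \<Rightarrow> nat \<Rightarrow> (nat list \<Rightarrow> real) \<Rightarrow> real" where
  "mean p 0 g = g []"
| "mean p (Suc n) g = (1 - p) * mean p n (\<lambda>w. g (0 # w)) + p * mean p n (\<lambda>w. g (1 # w))"

lemma mean_add: "mean p n (\<lambda>w. f w + g w) = mean p n f + mean p n g"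
  by (induction n arbitrary: f g) (simp_all add: algebra_simps)

lemma mean_cmult: "mean p n (\<lambda>w. c * g w) = c * mean p n g"
  by (induction n arbitrary: g) (simp_all add: algebra_simps)

lemma mean_sum: "finite A \<Longrightarrow> mean p n (\<lambda>w. \<Sum>x\<in>A. g x w) = (\<Sum>x\<in>A. mean p n (g x))"
proof (induction A rule: finite_induct)
  case empty
  show ?case using mean_cmult[of p n 0] by simp
qed (simp add: mean_add)

lemma mean_const_0 [simp]: "mean p n (\<lambda>w. 0) = 0"
  using mean_cmult[of p n 0] by simp

text \<open>Conditioning on the latest \<open>k\<close> letters: each prescribed letter contributes
  its probability as a factor, and what remains is a mean over a free word.\<close>

lemma mean_replicate_prefix:
  assumes "b \<in> {0, 1}"
  shows "mean p n (\<lambda>w. g w * of_bool (\<exists>v. w = replicate k b @ v \<and> P v)) =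
     (if k \<le> n then (if b = 0 then 1 - p else p) ^ k *
        mean p (n - k) (\<lambda>v. g (replicate k b @ v) * of_bool (P v)) else 0)"
proof (induction k arbitrary: n g)
  case (Suc k)
  show ?case
  proof (cases n)
    case (Suc n')
    have "(\<exists>v. c # w = replicate (Suc k) b @ v \<and> P v) \<longleftrightarrow> c = b \<and> (\<exists>v. w = replicate k b @ v \<and> P v)" for c w
      by auto
    then show ?thesis
      using assms Suc Suc.IH[of n' "\<lambda>w. g (b # w)"] by auto
  qed simp
qed simp

lemma mean_pattern_before:
  "mean p n (\<lambda>w. g w * of_bool (pattern_before w j i)) =
     (if j + i \<le> n then (1 - p) ^ j * p ^ i *
        mean p (n - (j + i)) (\<lambda>v. g (replicate i 1 @ replicate j 0 @ v) * of_bool (block_start v)) else 0)"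
proof -
  have "pattern_before w j i \<longleftrightarrow>
      (\<exists>u. w = replicate i 1 @ u \<and> (\<exists>v. u = replicate j 0 @ v \<and> block_start v))" for w
    by (auto simp: pattern_before_def)
  then show ?thesis
    by (simp add: mean_replicate_prefix) (auto simp: add.commute)
qed

text \<open>Among words over 0 and 1, \<open>block_start\<close> fails exactly for those with latest
  letter 0; subtracting these enforces maximality of the block of zeros. The empty word has no such
  letter, hence the case \<open>n = 0\<close>.\<close>

lemma mean_block_start:
  "mean p n (\<lambda>v. g v * of_bool (block_start v)) =
     mean p n g - (if n = 0 then 0 else (1 - p) * mean p (n - 1) (\<lambda>v. g (0 # v)))"
  by (cases n) (simp_all add: block_start_def)

text \<open>The second relation of the overview, for each \<open>n\<close>. The inner case
  distinction drops the correction when nothing precedes the block, which is then maximal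
  automatically.\<close>

lemma mean_power_count_0_Cons:
  fixes p t :: real and J I :: "nat set"
  assumes "\<And>j. j \<in> J \<Longrightarrow> 1 \<le> j" "\<And>i. i \<in> I \<Longrightarrow> 1 \<le> i" "finite J" "finite I"
  defines "E \<equiv> \<lambda>n. mean p n (\<lambda>w. t ^ count_patterns J I (0 # w))"
  shows "E n = mean p n (\<lambda>w. t ^ count_patterns J I w) + (t - 1) *
     (\<Sum>j\<in>J. \<Sum>i\<in>I. if j + i \<le> n then (1 - p) ^ j * p ^ i *
        (E (n - (j + i)) - (if n - (j + i) = 0 then 0 else (1 - p) * E (n - (j + i) - 1))) else 0)"
proof -
  let ?c = "count_patterns J I"
  have "t ^ ?c (0 # w) = t ^ ?c w + (t - 1) * (\<Sum>j\<in>J. \<Sum>i\<in>I. t ^ ?c w * of_bool (pattern_before w j i))" for w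
  proof -
    have "t ^ new_patterns J I w = 1 + (t - 1) * real (new_patterns J I w)"
      using new_patterns_le_1[of J I w] assms(1) by (cases "new_patterns J I w") auto
    then have "t ^ ?c w * t ^ new_patterns J I w = t ^ ?c w +
        (t - 1) * (t ^ ?c w * (\<Sum>j\<in>J. \<Sum>i\<in>I. of_bool (pattern_before w j i)))"
      unfolding new_patterns_eq_sum[OF assms(3,4)] by (simp add: distrib_left)
    then show ?thesis by (simp add: power_add sum_distrib_left)
  qed
  then have "E n = mean p n (\<lambda>w. t ^ ?c w) + (t - 1) *
      (\<Sum>j\<in>J. \<Sum>i\<in>I. mean p n (\<lambda>w. t ^ ?c w * of_bool (pattern_before w j i)))"
    unfolding E_def using assms(3,4) by (simp only: mean_add mean_cmult mean_sum)
  moreover have "mean p n (\<lambda>w. t ^ ?c w * of_bool (pattern_before w j i)) =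
      (if j + i \<le> n then (1 - p) ^ j * p ^ i *
        (E (n - (j + i)) - (if n - (j + i) = 0 then 0 else (1 - p) * E (n - (j + i) - 1))) else 0)"
    if "j \<in> J" for j i
  proof -
    \<comment> \<open>After deletion of the block the word \<open>v\<close> is again closed by a 0,
      which reproduces \<open>E\<close>.\<close>
    have c: "?c (replicate i 1 @ replicate j 0 @ v) = ?c (0 # v)" for v
      using that assms by (intro count_patterns_replicate) auto
    \<comment> \<open>A second closing 0 changes nothing, so the correction for maximality is again
      an \<open>E\<close>, one letter shorter.\<close>
    have cc: "?c (0 # 0 # v) = ?c (0 # v)" for v
      using new_patterns_0_Cons[of I J v] assms(2) by simp
    show ?thesis
      unfolding mean_pattern_before c mean_block_start cc E_def by simp
  qed
  ultimately show ?thesis by simp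
qed

section \<open>From the probability space to means over words\<close>

lemma mean_eq_sum_words:
  "mean p n g =
     (\<Sum>w | set w \<subseteq> {0, 1} \<and> length w = n. (\<Prod>h\<in>{1..n}. if w ! (n - h) = 0 then 1 - p else p) * g w)"
proof (induction n arbitrary: g)
  case 0
  have "{w :: nat list. set w \<subseteq> {0, 1} \<and> length w = 0} = {[]}" by auto
  then show ?case by simp
next
  case (Suc n)
  define A where "A n = {w :: nat list. set w \<subseteq> {0, 1} \<and> length w = n}" for n
  define c where "c w n = (\<Prod>h\<in>{1..n}. if w ! (n - h) = 0 then 1 - p else p)" for w :: "nat list" and n
  have fin: "finite (A n)" for n
    unfolding A_def by (rule finite_lists_length_eq) simp
  have A: "A (Suc n) = (\<lambda>w. 0 # w) ` A n \<union> (\<lambda>w. 1 # w) ` A n"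
    unfolding A_def by (auto simp: length_Suc_conv)
  have c: "c (b # w) (Suc n) = (if b = 0 then 1 - p else p) * c w n" for b w
    unfolding c_def by (simp add: atLeastAtMostSuc_conv Suc_diff_le)
  have "(\<Sum>w\<in>A (Suc n). c w (Suc n) * g w) =
      (\<Sum>w\<in>A n. c (0 # w) (Suc n) * g (0 # w)) + (\<Sum>w\<in>A n. c (1 # w) (Suc n) * g (1 # w))"
    unfolding A by (subst sum.union_disjoint) (auto simp: fin sum.reindex)
  also have "\<dots> = mean p (Suc n) g"
    using Suc[folded A_def c_def] by (simp add: c sum_distrib_left mult.assoc)
  finally show ?case by (simp add: A_def c_def)
qed

text \<open>The \<open>X i\<close> may take values outside 0 and 1 on a null set, so the history is
  a binary word only almost surely. This reduces the expectation to a finite sum over words, and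
  independence turns the probability of each word into a product.\<close>

lemma (in prob_space) expectation_history:
  fixes X :: "nat \<Rightarrow> 'a \<Rightarrow> nat"
  assumes indep: "indep_vars (\<lambda>_. count_space UNIV) X {1..}"
    and one: "\<And>i. i \<ge> 1 \<Longrightarrow> prob {\<omega> \<in> space M. X i \<omega> = 1} = p"
    and zero: "\<And>i. i \<ge> 1 \<Longrightarrow> prob {\<omega> \<in> space M. X i \<omega> = 0} = 1 - p"
  shows "expectation (\<lambda>\<omega>. g (history (\<lambda>i. X i \<omega>) n)) = mean p n g"
proof -
  define h where "h \<omega> = history (\<lambda>i. X i \<omega>) n" for \<omega>
  define A where "A = {w :: nat list. set w \<subseteq> {0, 1} \<and> length w = n}"
  have X [measurable]: "X i \<in> measurable M (count_space UNIV)" if "i \<ge> 1" for i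
    using indep that by (auto simp: indep_vars_def2)
  have h [measurable]: "h \<in> measurable M (count_space UNIV)"
  proof -
    have "(\<lambda>\<omega>. history (\<lambda>i. X i \<omega>) m) \<in> measurable M (count_space UNIV)" for m
    proof (induction m)
      case (Suc m)
      have [measurable]: "X (Suc m) \<in> measurable M (count_space UNIV)" by (rule X) simp
      note Suc [measurable]
      show ?case by simp
    qed simp
    then show ?thesis by (simp add: h_def[abs_def])
  qed
  have AE01: "AE \<omega> in M. X i \<omega> \<in> {0, 1}" if "i \<ge> 1" for i
  proof -
    have [measurable]: "X i \<in> measurable M (count_space UNIV)" using X that .
    have "prob {\<omega> \<in> space M. X i \<omega> = 0 \<or> X i \<omega> = 1} =
        prob ({\<omega> \<in> space M. X i \<omega> = 0} \<union> {\<omega> \<in> space M. X i \<omega> = 1})"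
      by (rule arg_cong[of _ _ prob]) auto
    also have "\<dots> = 1"
      using one[OF that] zero[OF that] by (subst finite_measure_Union) auto
    finally have "AE \<omega> in M. X i \<omega> = 0 \<or> X i \<omega> = 1"
      by (subst prob_Collect_eq_1[symmetric]) auto
    then show ?thesis by simp
  qed
  have hA: "AE \<omega> in M. h \<omega> \<in> A"
  proof -
    have "AE \<omega> in M. \<forall>i\<in>{1..n}. X i \<omega> \<in> {0, 1}"
      by (rule AE_finite_allI) (use AE01 in auto)
    moreover have "set (history x n) = x ` {1..n}" for x :: "nat \<Rightarrow> nat"
      by (induction n) (auto simp: atLeastAtMostSuc_conv)
    ultimately show ?thesis
      by (auto simp: A_def h_def elim!: eventually_mono)
  qed
  have ph: "prob {\<omega> \<in> space M. h \<omega> = w} = (\<Prod>k\<in>{1..n}. if w ! (n - k) = 0 then 1 - p else p)"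
    if w: "w \<in> A" for w
  \<comment> \<open>\<open>indep_varsD\<close> asks for a nonempty index set, so the empty word is
    treated apart.\<close>
  proof (cases "n = 0")
    case True
    then show ?thesis using w by (simp add: h_def A_def prob_space)
  next
    case False
    have "{\<omega> \<in> space M. h \<omega> = w} = (\<Inter>k\<in>{1..n}. X k -` {w ! (n - k)} \<inter> space M)"
      using False w by (auto simp: h_def history_eq_iff A_def)
    also have "prob \<dots> = (\<Prod>k\<in>{1..n}. prob (X k -` {w ! (n - k)} \<inter> space M))"
      using False by (intro indep_varsD[OF indep]) auto
    also have "\<dots> = (\<Prod>k\<in>{1..n}. if w ! (n - k) = 0 then 1 - p else p)"
    proof (rule prod.cong)
      fix k assume k: "k \<in> {1..n}"
      then have "w ! (n - k) \<in> set w" using w by (intro nth_mem) (auto simp: A_def)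
      then have "w ! (n - k) \<in> {0, 1}" using w by (auto simp: A_def)
      moreover have "X k -` {b} \<inter> space M = {\<omega> \<in> space M. X k \<omega> = b}" for b by auto
      ultimately show "prob (X k -` {w ! (n - k)} \<inter> space M) = (if w ! (n - k) = 0 then 1 - p else p)"
        using k one[of k] zero[of k] by auto
    qed simp
    finally show ?thesis .
  qed
  have finA: "finite A"
    unfolding A_def by (rule finite_lists_length_eq) simp
  have "expectation (\<lambda>\<omega>. g (h \<omega>)) =
      expectation (\<lambda>\<omega>. \<Sum>w\<in>A. g w * indicator {\<omega> \<in> space M. h \<omega> = w} \<omega>)"
  proof (rule integral_cong_AE)
    show "AE \<omega> in M. g (h \<omega>) = (\<Sum>w\<in>A. g w * indicator {\<omega> \<in> space M. h \<omega> = w} \<omega>)"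
      using hA AE_space
    proof eventually_elim
      case (elim \<omega>)
      then have "(\<Sum>w\<in>A. g w * indicator {\<omega> \<in> space M. h \<omega> = w} \<omega>) =
          (\<Sum>w\<in>A. if w = h \<omega> then g w else 0)"
        by (intro sum.cong) auto
      with elim finA show ?case by simp
    qed
  qed auto
  also have "\<dots> = (\<Sum>w\<in>A. g w * prob {\<omega> \<in> space M. h \<omega> = w})"
    by (subst Bochner_Integration.integral_sum) (auto simp: Int_absorb1 less_top[symmetric])
  also have "\<dots> = mean p n g"
    unfolding mean_eq_sum_words A_def[symmetric] using ph by (simp add: mult.commute)
  finally show ?thesis by (simp add: h_def)
qed

section \<open>Five-part multinomial sums and their generating function\<close>

definition solutions :: "nat \<Rightarrow> nat \<Rightarrow> nat \<Rightarrow> nat \<Rightarrow> nat \<Rightarrow> (nat \<times> nat \<times> nat \<times> nat \<times> nat) set" where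
  "solutions c1 c2 c3 c4 n =
     {(f, u, w, r, v). f + u * c1 + w * c2 + r * c3 + v * c4 = n}"

text \<open>For positive weights this is the coefficient of \<open>X^n\<close> in
  \<open>1 / (1 - X - x1 X^c1 - x2 X^c2 - x3 X^c3 - x4 X^c4)\<close>, by the multinomial theorem.
  The part \<open>f\<close> is the exponent of the plain monomial \<open>X\<close>, so it has weight
  1 and no factor.\<close>

definition sol_sum :: "nat \<Rightarrow> nat \<Rightarrow> nat \<Rightarrow> nat \<Rightarrow> real \<Rightarrow> real \<Rightarrow> real \<Rightarrow> real \<Rightarrow> nat \<Rightarrow> real" where
  "sol_sum c1 c2 c3 c4 x1 x2 x3 x4 n =
     (\<Sum>(f, u, w, r, v)\<in>solutions c1 c2 c3 c4 n.
        multinomial (f + u + v + r + w) [f, u, w, r, v] * x1 ^ u * x2 ^ w * x3 ^ r * x4 ^ v)"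

lemma finite_solutions:
  assumes "0 < c1" "0 < c2" "0 < c3" "0 < c4"
  shows "finite (solutions c1 c2 c3 c4 n)"
proof (rule finite_subset)
  show "solutions c1 c2 c3 c4 n \<subseteq> {..n} \<times> {..n} \<times> {..n} \<times> {..n} \<times> {..n}"
  proof
    fix z assume "z \<in> solutions c1 c2 c3 c4 n"
    then obtain f u w r v where "z = (f, u, w, r, v)" "f + u * c1 + w * c2 + r * c3 + v * c4 = n"
      by (auto simp: solutions_def)
    moreover have "u \<le> u * c1" "w \<le> w * c2" "r \<le> r * c3" "v \<le> v * c4"
      using assms by simp_all
    ultimately have "f \<le> n \<and> u \<le> n \<and> w \<le> n \<and> r \<le> n \<and> v \<le> n" by linarith
    with \<open>z = _\<close> show "z \<in> {..n} \<times> {..n} \<times> {..n} \<times> {..n} \<times> {..n}" by simp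
  qed
qed auto

text \<open>Over the common denominator \<open>D\<close>, lowering a part \<open>x\<close> by one
  gives \<open>N! x / D\<close>, and the parts add up to \<open>N + 1\<close>. The guards keep
  truncated subtraction from producing spurious terms when a part is 0.\<close>

lemma multinomial_pascal:
  assumes "f + u + v + r + w = Suc N"
  shows "multinomial (Suc N) [f, u, w, r, v] =
    (if f = 0 then 0 else multinomial N [f - 1, u, w, r, v]) +
    (if u = 0 then 0 else multinomial N [f, u - 1, w, r, v]) +
    (if w = 0 then 0 else multinomial N [f, u, w - 1, r, v]) +
    (if r = 0 then 0 else multinomial N [f, u, w, r - 1, v]) +
    (if v = 0 then 0 else multinomial N [f, u, w, r, v - 1])"
proof -
  define D :: real where "D = fact f * fact u * fact w * fact r * fact v"
  have D: "D \<noteq> 0" by (simp add: D_def)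
  have 1: "(if f = 0 then 0 else multinomial N [f - 1, u, w, r, v]) = fact N * real f / D"
    by (cases f) (simp_all add: multinomial_def D_def frac_eq_eq mult_ac del: of_nat_Suc)
  have 2: "(if u = 0 then 0 else multinomial N [f, u - 1, w, r, v]) = fact N * real u / D"
    by (cases u) (simp_all add: multinomial_def D_def frac_eq_eq mult_ac del: of_nat_Suc)
  have 3: "(if w = 0 then 0 else multinomial N [f, u, w - 1, r, v]) = fact N * real w / D"
    by (cases w) (simp_all add: multinomial_def D_def frac_eq_eq mult_ac del: of_nat_Suc)
  have 4: "(if r = 0 then 0 else multinomial N [f, u, w, r - 1, v]) = fact N * real r / D"
    by (cases r) (simp_all add: multinomial_def D_def frac_eq_eq mult_ac del: of_nat_Suc)
  have 5: "(if v = 0 then 0 else multinomial N [f, u, w, r, v - 1]) = fact N * real v / D"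
    by (cases v) (simp_all add: multinomial_def D_def frac_eq_eq mult_ac del: of_nat_Suc)
  have "multinomial (Suc N) [f, u, w, r, v] = fact N * real (Suc N) / D"
    by (simp add: multinomial_def D_def mult_ac)
  also have "\<dots> = fact N * (real f + real u + real w + real r + real v) / D"
    unfolding assms[symmetric] by simp
  finally show ?thesis unfolding 1 2 3 4 5 by (simp add: add_divide_distrib distrib_left)
qed

lemma sol_sum_0:
  assumes "0 < c1" "0 < c2" "0 < c3" "0 < c4"
  shows "sol_sum c1 c2 c3 c4 x1 x2 x3 x4 0 = 1"
proof -
  have "solutions c1 c2 c3 c4 0 = {(0, 0, 0, 0, 0)}"
    using assms by (auto simp: solutions_def)
  then show ?thesis by (simp add: sol_sum_def multinomial_def)
qed

text \<open>Pascal's rule takes one unit from one of the five parts; lowering a part of weight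
  \<open>c\<close> turns solutions for \<open>Suc n\<close> into solutions for
  \<open>Suc n - c\<close>. \<open>G\<close> supplies 0 for negative indices.\<close>

lemma sol_sum_Suc:
  fixes c1 c2 c3 c4 n :: nat and x1 x2 x3 x4 :: real
  assumes c: "0 < c1" "0 < c2" "0 < c3" "0 < c4"
  defines "F \<equiv> sol_sum c1 c2 c3 c4 x1 x2 x3 x4"
  defines "G \<equiv> \<lambda>c k. if c \<le> k then F (k - c) else 0"
  shows "F (Suc n) = F n + x1 * G c1 (Suc n) + x2 * G c2 (Suc n) + x3 * G c3 (Suc n) + x4 * G c4 (Suc n)"
proof -
  define S where "S = solutions c1 c2 c3 c4"
  define T where "T = (\<lambda>(f, u, w, r, v).
     multinomial (f + u + v + r + w) [f, u, w, r, v] * x1 ^ u * x2 ^ w * x3 ^ r * x4 ^ v)"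
  have fin: "finite (S k)" for k unfolding S_def using c by (rule finite_solutions)
  have F: "F k = sum T (S k)" for k by (simp add: F_def S_def T_def sol_sum_def)
  have S: "(f, u, w, r, v) \<in> S k \<longleftrightarrow> f + u * c1 + w * c2 + r * c3 + v * c4 = k" for f u w r v k
    by (simp add: S_def solutions_def)
  \<comment> \<open>The five summands of Pascal's rule, with one factor \<open>x1\<close>, ...,
    \<open>x4\<close> taken out where there is one, so that a shifted \<open>T\<close>
    remains.\<close>
  let ?s0 = "\<lambda>(f, u, w, r, v). if f = 0 then 0 else T (f - 1, u, w, r, v)"
  let ?s1 = "\<lambda>(f, u, w, r, v). if u = 0 then 0 else T (f, u - 1, w, r, v)"
  let ?s2 = "\<lambda>(f, u, w, r, v). if w = 0 then 0 else T (f, u, w - 1, r, v)"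
  let ?s3 = "\<lambda>(f, u, w, r, v). if r = 0 then 0 else T (f, u, w, r - 1, v)"
  let ?s4 = "\<lambda>(f, u, w, r, v). if v = 0 then 0 else T (f, u, w, r, v - 1)"
  have "T z = ?s0 z + x1 * ?s1 z + x2 * ?s2 z + x3 * ?s3 z + x4 * ?s4 z" if "z \<in> S (Suc n)" for z
  proof -
    obtain f u w r v where z: "z = (f, u, w, r, v)" by (cases z)
    have "f + u + v + r + w \<noteq> 0"
    proof
      assume "f + u + v + r + w = 0"
      then have "f = 0" "u = 0" "v = 0" "r = 0" "w = 0" by simp_all
      with that show False by (simp add: z S)
    qed
    then obtain N where N: "f + u + v + r + w = Suc N" by (metis not0_implies_Suc)
    have T: "T z = multinomial (Suc N) [f, u, w, r, v] * x1 ^ u * x2 ^ w * x3 ^ r * x4 ^ v"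
      using N by (simp add: T_def z)
    have "?s0 z = (if f = 0 then 0 else multinomial N [f - 1, u, w, r, v]) * x1 ^ u * x2 ^ w * x3 ^ r * x4 ^ v"
      using N by (cases f) (auto simp: T_def z)
    moreover have "x1 * ?s1 z = (if u = 0 then 0 else multinomial N [f, u - 1, w, r, v]) * x1 ^ u * x2 ^ w * x3 ^ r * x4 ^ v"
      using N by (cases u) (auto simp: T_def z)
    moreover have "x2 * ?s2 z = (if w = 0 then 0 else multinomial N [f, u, w - 1, r, v]) * x1 ^ u * x2 ^ w * x3 ^ r * x4 ^ v"
      using N by (cases w) (auto simp: T_def z)
    moreover have "x3 * ?s3 z = (if r = 0 then 0 else multinomial N [f, u, w, r - 1, v]) * x1 ^ u * x2 ^ w * x3 ^ r * x4 ^ v"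
      using N by (cases r) (auto simp: T_def z)
    moreover have "x4 * ?s4 z = (if v = 0 then 0 else multinomial N [f, u, w, r, v - 1]) * x1 ^ u * x2 ^ w * x3 ^ r * x4 ^ v"
      using N by (cases v) (auto simp: T_def z)
    ultimately show ?thesis unfolding T multinomial_pascal[OF N]
      by (simp only: distrib_right)
  qed
  then have "F (Suc n) = sum ?s0 (S (Suc n)) + x1 * sum ?s1 (S (Suc n)) + x2 * sum ?s2 (S (Suc n))
      + x3 * sum ?s3 (S (Suc n)) + x4 * sum ?s4 (S (Suc n))"
    unfolding F by (simp add: sum.distrib sum_distrib_left)
  moreover have "sum ?s0 (S (Suc n)) = F n"
  proof -
    have "F n = sum T (S n)" by (rule F)
    also have "\<dots> = sum ?s0 (S (Suc n) \<inter> {z. fst z \<noteq> 0})"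
      by (rule sum.reindex_bij_witness[where i = "\<lambda>(f, u, w, r, v). (f - 1, u, w, r, v)"
            and j = "\<lambda>(f, u, w, r, v). (f + 1, u, w, r, v)"]) (auto simp: S)
    \<comment> \<open>The added solutions have \<open>f = 0\<close>, where the guard makes the
      summand 0.\<close>
    also have "\<dots> = sum ?s0 (S (Suc n))"
      by (rule sum.mono_neutral_left) (auto simp: fin split: if_splits)
    finally show ?thesis by simp
  qed
  moreover have "sum ?s1 (S (Suc n)) = G c1 (Suc n)"
  proof (cases "c1 \<le> Suc n")
    case True
    have "F (Suc n - c1) = sum T (S (Suc n - c1))" by (rule F)
    also have "\<dots> = sum ?s1 (S (Suc n) \<inter> {(f, u, w, r, v). u \<noteq> 0})"
      by (rule sum.reindex_bij_witness[where i = "\<lambda>(f, u, w, r, v). (f, u - 1, w, r, v)"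
            and j = "\<lambda>(f, u, w, r, v). (f, u + 1, w, r, v)"])
         (use True in \<open>auto simp: S gr0_conv_Suc\<close>)
    also have "\<dots> = sum ?s1 (S (Suc n))"
      by (rule sum.mono_neutral_left) (auto simp: fin split: if_splits)
    finally show ?thesis using True by (simp add: G_def)
  next
    \<comment> \<open>Here \<open>c1\<close> exceeds \<open>Suc n\<close>, so every solution has
      \<open>u = 0\<close> and every summand vanishes.\<close>
    case False
    then show ?thesis by (auto simp: G_def S gr0_conv_Suc intro!: sum.neutral)
  qed
  moreover have "sum ?s2 (S (Suc n)) = G c2 (Suc n)"
  proof (cases "c2 \<le> Suc n")
    case True
    have "F (Suc n - c2) = sum T (S (Suc n - c2))" by (rule F)
    also have "\<dots> = sum ?s2 (S (Suc n) \<inter> {(f, u, w, r, v). w \<noteq> 0})"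
      by (rule sum.reindex_bij_witness[where i = "\<lambda>(f, u, w, r, v). (f, u, w - 1, r, v)"
            and j = "\<lambda>(f, u, w, r, v). (f, u, w + 1, r, v)"])
         (use True in \<open>auto simp: S gr0_conv_Suc\<close>)
    also have "\<dots> = sum ?s2 (S (Suc n))"
      by (rule sum.mono_neutral_left) (auto simp: fin split: if_splits)
    finally show ?thesis using True by (simp add: G_def)
  next
    case False
    then show ?thesis by (auto simp: G_def S gr0_conv_Suc intro!: sum.neutral)
  qed
  moreover have "sum ?s3 (S (Suc n)) = G c3 (Suc n)"
  proof (cases "c3 \<le> Suc n")
    case True
    have "F (Suc n - c3) = sum T (S (Suc n - c3))" by (rule F)
    also have "\<dots> = sum ?s3 (S (Suc n) \<inter> {(f, u, w, r, v). r \<noteq> 0})"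
      by (rule sum.reindex_bij_witness[where i = "\<lambda>(f, u, w, r, v). (f, u, w, r - 1, v)"
            and j = "\<lambda>(f, u, w, r, v). (f, u, w, r + 1, v)"])
         (use True in \<open>auto simp: S gr0_conv_Suc\<close>)
    also have "\<dots> = sum ?s3 (S (Suc n))"
      by (rule sum.mono_neutral_left) (auto simp: fin split: if_splits)
    finally show ?thesis using True by (simp add: G_def)
  next
    case False
    then show ?thesis by (auto simp: G_def S gr0_conv_Suc intro!: sum.neutral)
  qed
  moreover have "sum ?s4 (S (Suc n)) = G c4 (Suc n)"
  proof (cases "c4 \<le> Suc n")
    case True
    have "F (Suc n - c4) = sum T (S (Suc n - c4))" by (rule F)
    also have "\<dots> = sum ?s4 (S (Suc n) \<inter> {(f, u, w, r, v). v \<noteq> 0})"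
      by (rule sum.reindex_bij_witness[where i = "\<lambda>(f, u, w, r, v). (f, u, w, r, v - 1)"
            and j = "\<lambda>(f, u, w, r, v). (f, u, w, r, v + 1)"])
         (use True in \<open>auto simp: S gr0_conv_Suc\<close>)
    also have "\<dots> = sum ?s4 (S (Suc n))"
      by (rule sum.mono_neutral_left) (auto simp: fin split: if_splits)
    finally show ?thesis using True by (simp add: G_def)
  next
    case False
    then show ?thesis by (auto simp: G_def S gr0_conv_Suc intro!: sum.neutral)
  qed
  ultimately show ?thesis by simp
qed

lemma fps_sol_sum:
  fixes c1 c2 c3 c4 :: nat and x1 x2 x3 x4 :: real
  assumes c: "0 < c1" "0 < c2" "0 < c3" "0 < c4"
  shows "Abs_fps (sol_sum c1 c2 c3 c4 x1 x2 x3 x4) *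
    (1 - fps_X - fps_const x1 * fps_X ^ c1 - fps_const x2 * fps_X ^ c2
       - fps_const x3 * fps_X ^ c3 - fps_const x4 * fps_X ^ c4) = 1"
    (is "?F * _ = 1")
proof -
  have "?F = 1 + fps_X * ?F + fps_const x1 * (fps_X ^ c1 * ?F) + fps_const x2 * (fps_X ^ c2 * ?F)
      + fps_const x3 * (fps_X ^ c3 * ?F) + fps_const x4 * (fps_X ^ c4 * ?F)" (is "_ = ?R")
  proof (rule fps_ext)
    fix n
    show "fps_nth ?F n = fps_nth ?R n"
    proof (cases n)
      case 0
      then show ?thesis using c sol_sum_0[OF c] by (simp add: fps_X_power_mult_nth)
    next
      case (Suc k)
      show ?thesis unfolding Suc fps_nth_Abs_fps sol_sum_Suc[OF c]
        by (simp add: fps_X_power_mult_nth not_le)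
    qed
  qed
  then show ?thesis by (simp add: algebra_simps)
qed

section \<open>The nested sums of \<open>varphi\<close> and \<open>kappa\<close> as sums over
  solutions\<close>

lemma nested_sum_eq_sum_solutions:
  fixes T :: "nat \<Rightarrow> nat \<Rightarrow> nat \<Rightarrow> nat \<Rightarrow> nat \<Rightarrow> real"
  assumes "0 < l"
  shows "(\<Sum>u = 0..nat (int n div int l).
      \<Sum>w = 0..nat ((int n - int (u * l)) div int (l + m1)).
      \<Sum>r = 0..nat (fpar l m1 m2 (int n) u w 0 0 div int (l + m2)).
      \<Sum>v = 0..nat (fpar l m1 m2 (int n) u w r 0 div int (l + m1 + m2)).
        T (nat (fpar l m1 m2 (int n) u w r v)) u w r v) =
    (\<Sum>(f, u, w, r, v)\<in>solutions l (l + m1) (l + m2) (l + m1 + m2) n. T f u w r v)"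
proof -
  \<comment> \<open>Nonnegativity of \<open>x\<close> matters: for negative \<open>x\<close> the
    left side is {0} because of \<open>nat\<close>, while the right side is empty.\<close>
  have range: "{0..nat (x div int c)} = {b. int (b * c) \<le> x}" if x: "0 \<le> x" and c: "0 < c" for x c
  proof -
    obtain k where k: "x = int k" by (rule nonneg_int_cases[OF x])
    have "b \<le> nat (x div int c) \<longleftrightarrow> b * c \<le> k" for b
      unfolding k zdiv_int[symmetric] nat_int using c by (simp only: less_eq_div_iff_mult_less_eq)
    moreover have "int (b * c) \<le> x \<longleftrightarrow> b * c \<le> k" for b
      unfolding k by (rule of_nat_le_iff)
    ultimately show ?thesis by (simp only: atLeast0AtMost atMost_def)
  qed
  let ?f = "fpar l m1 m2 (int n)"
  define A where "A = {u. int (u * l) \<le> int n}"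
  define B where "B u = {w. int (w * (l + m1)) \<le> int n - int (u * l)}" for u
  define C where "C u w = {r. int (r * (l + m2)) \<le> ?f u w 0 0}" for u w
  define D where "D u w r = {v. int (v * (l + m1 + m2)) \<le> ?f u w r 0}" for u w r
  have A: "{0..nat (int n div int l)} = A"
    unfolding A_def using assms by (intro range) auto
  have B: "{0..nat ((int n - int (u * l)) div int (l + m1))} = B u" if "u \<in> A" for u
    unfolding B_def using assms that by (intro range) (auto simp: A_def)
  have C: "{0..nat (?f u w 0 0 div int (l + m2))} = C u w" if "u \<in> A" "w \<in> B u" for u w
    unfolding C_def using assms that by (intro range) (auto simp: A_def B_def fpar_def)
  have D: "{0..nat (?f u w r 0 div int (l + m1 + m2))} = D u w r" if "u \<in> A" "w \<in> B u" "r \<in> C u w" for u w r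
    unfolding D_def using assms that by (intro range) (auto simp: A_def B_def C_def fpar_def)
  have finA: "finite A" using A by (metis finite_atLeastAtMost)
  have finB: "finite (B u)" if "u \<in> A" for u using B[OF that] by (metis finite_atLeastAtMost)
  have finC: "finite (C u w)" if "u \<in> A" "w \<in> B u" for u w
    using C[OF that] by (metis finite_atLeastAtMost)
  have finD: "finite (D u w r)" if "u \<in> A" "w \<in> B u" "r \<in> C u w" for u w r
    using D[OF that] by (metis finite_atLeastAtMost)
  let ?t = "\<lambda>u w r v. T (nat (?f u w r v)) u w r v"
  have "(\<Sum>u\<in>A. \<Sum>w\<in>B u. \<Sum>r\<in>C u w. \<Sum>v\<in>D u w r. ?t u w r v) =
      (\<Sum>u\<in>A. \<Sum>w\<in>B u. \<Sum>(r, v)\<in>(SIGMA r:C u w. D u w r). ?t u w r v)"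
    by (intro sum.cong refl sum.Sigma ballI finC finD)
  also have "\<dots> = (\<Sum>u\<in>A. \<Sum>(w, r, v)\<in>(SIGMA w:B u. SIGMA r:C u w. D u w r). ?t u w r v)"
    by (intro sum.cong refl sum.Sigma ballI finB finC finD finite_SigmaI)
  also have "\<dots> = (\<Sum>(u, w, r, v)\<in>(SIGMA u:A. SIGMA w:B u. SIGMA r:C u w. D u w r). ?t u w r v)"
    by (intro sum.Sigma ballI finA finB finC finD finite_SigmaI)
  also have "\<dots> = (\<Sum>(f, u, w, r, v)\<in>solutions l (l + m1) (l + m2) (l + m1 + m2) n. T f u w r v)"
  \<comment> \<open>Forgetting \<open>f\<close> and restoring it as the remainder
    \<open>fpar\<close> are mutually inverse.\<close>
  proof (rule sum.reindex_bij_witness[where i = snd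
        and j = "\<lambda>(u, w, r, v). (nat (?f u w r v), u, w, r, v)"])
    fix z assume "z \<in> (SIGMA u:A. SIGMA w:B u. SIGMA r:C u w. D u w r)"
    then obtain u w r v where z: "z = (u, w, r, v)" and "v \<in> D u w r" by auto
    then have "?f u w r v \<ge> 0" by (simp add: D_def fpar_def)
    then have "int (nat (?f u w r v) + u * l + w * (l + m1) + r * (l + m2) + v * (l + m1 + m2)) = int n"
      unfolding fpar_def by simp
    then have "nat (?f u w r v) + u * l + w * (l + m1) + r * (l + m2) + v * (l + m1 + m2) = n"
      by (simp only: of_nat_eq_iff)
    then show "(case z of (u, w, r, v) \<Rightarrow> (nat (?f u w r v), u, w, r, v))
        \<in> solutions l (l + m1) (l + m2) (l + m1 + m2) n"
      by (simp add: z solutions_def)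
  next
    fix z assume "z \<in> solutions l (l + m1) (l + m2) (l + m1 + m2) n"
    then obtain f u w r v where z: "z = (f, u, w, r, v)"
      and eq: "f + u * l + w * (l + m1) + r * (l + m2) + v * (l + m1 + m2) = n"
      by (auto simp: solutions_def)
    have eq': "int f + int (u * l) + int (w * (l + m1)) + int (r * (l + m2)) + int (v * (l + m1 + m2)) = int n"
      unfolding eq[symmetric] by (simp only: of_nat_add)
    then have "?f u w r v = int f" by (simp add: fpar_def)
    then show "(case snd z of (u, w, r, v) \<Rightarrow> (nat (?f u w r v), u, w, r, v)) = z"
      by (simp add: z)
    \<comment> \<open>With the products kept as atoms the membership claim is linear, and it needs
      their signs.\<close>
    have "0 \<le> int f" "0 \<le> int (u * l)" "0 \<le> int (w * (l + m1))" "0 \<le> int (r * (l + m2))"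
      "0 \<le> int (v * (l + m1 + m2))" by (simp_all only: of_nat_0_le_iff)
    then show "snd z \<in> (SIGMA u:A. SIGMA w:B u. SIGMA r:C u w. D u w r)"
      using eq' unfolding z A_def B_def C_def D_def fpar_def mem_Sigma_iff by (auto simp del: of_nat_mult of_nat_add)
  qed auto
  finally show ?thesis
    by (simp only: A B C D cong: sum.cong)
qed

text \<open>Splitting the powers by parts puts a sign and \<open>q ^ m1\<close> with
  \<open>w\<close>, a sign and \<open>p ^ m2\<close> with \<open>r\<close>, both powers without a
  sign with \<open>v\<close>, and a factor \<open>a * (t - 1)\<close> with each of the four.\<close>

lemma varphi_eq_sol_sum:
  assumes "0 < l"
  shows "varphi l m1 m2 p q a (int n) t =
    sol_sum l (l + m1) (l + m2) (l + m1 + m2) (a * (t - 1)) (- (a * (t - 1) * q ^ m1))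
      (- (a * (t - 1) * p ^ m2)) (a * (t - 1) * q ^ m1 * p ^ m2) n"
proof -
  define y where "y = a * (t - 1)"
  have eq: "(-1) ^ (w + r) * M * q ^ ((v + w) * m1) * p ^ ((v + r) * m2) * y ^ (u + w + r + v) =
    M * y ^ u * (- (y * q ^ m1)) ^ w * (- (y * p ^ m2)) ^ r * (y * q ^ m1 * p ^ m2) ^ v"
    for M :: real and u w r v :: nat
  proof -
    have neg: "(- (y * q ^ m1)) ^ w = (-1) ^ w * (y ^ w * (q ^ m1) ^ w)"
      "(- (y * p ^ m2)) ^ r = (-1) ^ r * (y ^ r * (p ^ m2) ^ r)"
      by (simp_all only: power_minus[of "y * _"] power_mult_distrib)
    have pow: "q ^ ((v + w) * m1) = (q ^ m1) ^ v * (q ^ m1) ^ w"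
      "p ^ ((v + r) * m2) = (p ^ m2) ^ v * (p ^ m2) ^ r"
      by (simp_all only: mult.commute[of "v + _"] power_mult power_add)
    show ?thesis
      unfolding neg pow by (simp only: power_add power_mult_distrib mult_ac)
  qed
  show ?thesis
    unfolding varphi_def Let_def y_def[symmetric] eq sol_sum_def
    by (subst nested_sum_eq_sum_solutions[symmetric, OF assms]) simp
qed

lemma kappa_eq_sum_solutions:
  assumes "0 < l"
  shows "kappa l m1 m2 p q a (int m) (int n) =
    (\<Sum>(f, u, w, r, v)\<in>solutions l (l + m1) (l + m2) (l + m1 + m2) n.
       (-1) powi (int u + int v - int m) * multinomial (f + u + v + r + w) [f, u, w, r, v]
          * real ((u + w + r + v) choose m)
          * q ^ ((v + w) * m1) * p ^ ((v + r) * m2) * a ^ (u + w + r + v))"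
  unfolding kappa_def Let_def
  by (subst nested_sum_eq_sum_solutions[symmetric, OF assms]) simp

text \<open>Expand \<open>(t - 1) ^ k\<close> with \<open>k = u + w + r + v\<close> by the binomial
  theorem and collect powers of \<open>t\<close>. Since \<open>k \<le> n \<le> N\<close>, one range
  of \<open>m\<close> serves all solutions and the two sums can be swapped.\<close>

lemma varphi_eq_sum_kappa:
  assumes "0 < l" "n \<le> N"
  shows "varphi l m1 m2 p q a (int n) t = (\<Sum>m\<le>N. kappa l m1 m2 p q a (int m) (int n) * t ^ m)"
proof -
  have pow: "(t - 1) ^ k = (\<Sum>m\<le>N. real (k choose m) * (-1) powi (int k - int m) * t ^ m)" if "k \<le> N" for k
  proof -
    have "(t - 1) ^ k = (\<Sum>m\<le>k. real (k choose m) * t ^ m * (-1) ^ (k - m))"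
      using binomial_ring[of t "-1" k] by simp
    also have "\<dots> = (\<Sum>m\<le>k. real (k choose m) * (-1) powi (int k - int m) * t ^ m)"
    proof (rule sum.cong)
      fix m assume "m \<in> {..k}"
      then have "(-1 :: real) powi (int k - int m) = (-1) ^ (k - m)"
        by (simp add: power_int_def nat_diff_distrib)
      then show "real (k choose m) * t ^ m * (-1) ^ (k - m) = real (k choose m) * (-1) powi (int k - int m) * t ^ m"
        by simp
    qed simp
    \<comment> \<open>Beyond \<open>k\<close> the binomial coefficient is 0, so negative exponents
      of -1 cause no harm.\<close>
    also have "\<dots> = (\<Sum>m\<le>N. real (k choose m) * (-1) powi (int k - int m) * t ^ m)"
      using that by (intro sum.mono_neutral_left) auto
    finally show ?thesis .
  qed
  let ?S = "solutions l (l + m1) (l + m2) (l + m1 + m2) n"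
  have "(\<Sum>m\<le>N. kappa l m1 m2 p q a (int m) (int n) * t ^ m) =
    (\<Sum>(f, u, w, r, v)\<in>?S. \<Sum>m\<le>N. (-1) powi (int u + int v - int m) * multinomial (f + u + v + r + w) [f, u, w, r, v]
          * real ((u + w + r + v) choose m)
          * q ^ ((v + w) * m1) * p ^ ((v + r) * m2) * a ^ (u + w + r + v) * t ^ m)"
    unfolding kappa_eq_sum_solutions[OF assms(1)]
    by (simp only: sum_distrib_right case_prod_unfold) (rule sum.swap)
  also have "\<dots> = (\<Sum>(f, u, w, r, v)\<in>?S. (-1) ^ (w + r) * multinomial (f + u + v + r + w) [f, u, w, r, v]
          * q ^ ((v + w) * m1) * p ^ ((v + r) * m2) * (a * (t - 1)) ^ (u + w + r + v))"
  proof (rule sum.cong, rule refl, clarify)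
    fix f u w r v assume z: "(f, u, w, r, v) \<in> ?S"
    have "u \<le> u * l" "w \<le> w * (l + m1)" "r \<le> r * (l + m2)" "v \<le> v * (l + m1 + m2)"
      using assms(1) by simp_all
    moreover have "f + u * l + w * (l + m1) + r * (l + m2) + v * (l + m1 + m2) = n"
      using z by (simp add: solutions_def)
    ultimately have "u + w + r + v \<le> N"
      using assms(2) by linarith
    note p = pow[OF this]
    \<comment> \<open>The sign \<open>(-1) ^ (w + r)\<close> of \<open>varphi\<close> cancels
      \<open>w + r\<close> in the exponent and leaves the \<open>u + v - m\<close> of
      \<open>kappa\<close>.\<close>
    have s: "(-1) powi (int u + int v - int m) = ((-1) ^ (w + r) * (-1) powi (int (u + w + r + v) - int m) :: real)" for m
    proof -
      have "(-1) powi (int (u + w + r + v) - int m) = ((-1) powi (int u + int v - int m) * (-1) powi (int (w + r)) :: real)"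
        by (subst power_int_add[symmetric]) (auto simp: algebra_simps)
      then have "(-1) powi (int (u + w + r + v) - int m) = ((-1) powi (int u + int v - int m) * (-1) ^ (w + r) :: real)"
        by (simp only: power_int_of_nat)
      then show ?thesis by (simp add: mult.left_commute[of "(- 1) ^ (w + r)"])
    qed
    show "(\<Sum>m\<le>N. (-1) powi (int u + int v - int m) * multinomial (f + u + v + r + w) [f, u, w, r, v]
          * real ((u + w + r + v) choose m)
          * q ^ ((v + w) * m1) * p ^ ((v + r) * m2) * a ^ (u + w + r + v) * t ^ m) =
       (-1) ^ (w + r) * multinomial (f + u + v + r + w) [f, u, w, r, v]
          * q ^ ((v + w) * m1) * p ^ ((v + r) * m2) * (a * (t - 1)) ^ (u + w + r + v)"
      unfolding power_mult_distrib p s by (simp only: sum_distrib_left mult_ac)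
  qed
  also have "\<dots> = varphi l m1 m2 p q a (int n) t"
    unfolding varphi_def Let_def
    by (subst nested_sum_eq_sum_solutions[symmetric, OF assms(1)]) simp
  finally show ?thesis by simp
qed

section \<open>Power series identities and claim (i) for means over words\<close>

lemma mean_power_count_formula:
  fixes p q a t :: real
  assumes p: "0 < p" and q: "q = 1 - p"
    and le: "1 \<le> l1" "l1 \<le> k1" "1 \<le> l2" "l2 \<le> k2"
    and a: "a = q ^ l1 * p ^ l2" and l: "l = l1 + l2" and m1: "m1 = k1 - l1 + 1" and m2: "m2 = k2 - l2 + 1"
  defines "\<phi> \<equiv> varphi l m1 m2 p q a"
  shows "mean p n (\<lambda>w. t ^ count_patterns {l1..k1} {l2..k2} w) =
    \<phi> (int n) t - a * (t - 1) *
      ((\<Sum>i = l..l + m2 - 1. p ^ (i - l) * \<phi> (int n - int i) t)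
       - (q / p) ^ m1 * (\<Sum>i = l + m1..l + m1 + m2 - 1. p ^ (i - l) * \<phi> (int n - int i) t))"
proof -
  let ?c = "count_patterns {l1..k1} {l2..k2}"
  define E where "E = Abs_fps (\<lambda>n. mean p n (\<lambda>w. t ^ ?c (0 # w)))"
  define F where "F = Abs_fps (\<lambda>n. mean p n (\<lambda>w. t ^ ?c w))"
  define y where "y = t - 1"
  \<comment> \<open>A letter 1 has weight \<open>P\<close> and a letter 0 has weight
    \<open>Q\<close>; the variable marks the length of the word.\<close>
  define P where "P = fps_const p * fps_X"
  define Q where "Q = fps_const q * fps_X"
  define SI where "SI = (\<Sum>i = l2..k2. P ^ i)"
  \<comment> \<open>The double sum over \<open>j\<close> and \<open>i\<close> times
    \<open>1 - Q\<close>, with only the sum over \<open>j\<close> in closed form: claim (i) displays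
    the sum over \<open>i\<close>, which telescopes in the denominator through
    \<open>(1 - P) * R\<close>.\<close>
  define R where "R = (Q ^ l1 - Q ^ Suc k1) * SI"
  have PQ: "P + Q = fps_X"
    by (simp add: P_def Q_def q flip: distrib_right)
  have F: "F = 1 + P * F + Q * E"
  proof (rule fps_ext)
    fix n show "fps_nth F n = fps_nth (1 + P * F + Q * E) n"
      by (cases n) (simp_all add: F_def E_def P_def Q_def q mult.assoc)
  qed
  have "E = F + fps_const y * (\<Sum>j = l1..k1. \<Sum>i = l2..k2. Q ^ j * P ^ i * (E - Q * E))"
  proof (rule fps_ext)
    fix n
    have "fps_nth (Q ^ j * P ^ i * (E - Q * E)) n =
       (if j + i \<le> n then (1 - p) ^ j * p ^ i *
        (fps_nth E (n - (j + i)) - (if n - (j + i) = 0 then 0 else (1 - p) * fps_nth E (n - (j + i) - 1))) else 0)" for i j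
    proof -
      have "Q ^ j * P ^ i * (E - Q * E) =
          fps_const (q ^ j * p ^ i) * (fps_X ^ (j + i) * (E - fps_const q * (fps_X * E)))"
        by (simp add: P_def Q_def power_mult_distrib power_add mult_ac flip: fps_const_mult)
      then show ?thesis
        by (simp add: fps_X_power_mult_nth q not_less)
    qed
    moreover have "fps_nth E n = fps_nth F n + y * (\<Sum>j = l1..k1. \<Sum>i = l2..k2. if j + i \<le> n then (1 - p) ^ j * p ^ i *
        (fps_nth E (n - (j + i)) - (if n - (j + i) = 0 then 0 else (1 - p) * fps_nth E (n - (j + i) - 1))) else 0)"
      unfolding E_def F_def y_def fps_nth_Abs_fps
      by (rule mean_power_count_0_Cons) (use le in auto)
    ultimately show "fps_nth E n = fps_nth (F + fps_const y * (\<Sum>j = l1..k1. \<Sum>i = l2..k2. Q ^ j * P ^ i * (E - Q * E))) n"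
      by (simp add: fps_sum_nth)
  qed
  also have "(\<Sum>j = l1..k1. \<Sum>i = l2..k2. Q ^ j * P ^ i * (E - Q * E)) =
      (\<Sum>j = l1..k1. Q ^ j) * SI * ((1 - Q) * E)"
    by (simp only: SI_def sum_product left_diff_distrib mult_1) (simp only: sum_distrib_right)
  also have "\<dots> = ((1 - Q) * (\<Sum>j = l1..k1. Q ^ j)) * SI * E"
    by (simp only: mult_ac)
  also have "(1 - Q) * (\<Sum>j = l1..k1. Q ^ j) = Q ^ l1 - Q ^ Suc k1"
    using le by (simp only: sum_gp_multiplied)
  finally have E: "E = F + fps_const y * (R * E)"
    by (simp add: R_def)
  have RP: "(1 - P) * R = (Q ^ l1 - Q ^ Suc k1) * (P ^ l2 - P ^ Suc k2)"
  proof -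
    have "(1 - P) * SI = P ^ l2 - P ^ Suc k2"
      unfolding SI_def using le by (simp only: sum_gp_multiplied)
    then show ?thesis by (simp only: R_def mult.left_commute[of "1 - P"])
  qed
  define Z where "Z = fps_const y * ((1 - P) * R)"
  define D where "D = 1 - fps_X - Z"
  \<comment> \<open>Multiply \<open>E = F + y R E\<close> by \<open>1 - P\<close> and eliminate
    \<open>F\<close> through \<open>(1 - P) F = 1 + Q E\<close>.\<close>
  have "E * D = 1"
  proof -
    have "(1 - P) * E = (1 - P) * F + Z * E"
      unfolding Z_def by (subst E) (simp only: distrib_left mult_ac)
    moreover have "(1 - P) * F = 1 + Q * E"
      using F by (simp add: algebra_simps)
    moreover have "E * D = (1 - P) * E - Q * E - Z * E"
      unfolding D_def PQ[symmetric] by (simp add: algebra_simps)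
    ultimately show ?thesis by simp
  qed
  define V where "V = Abs_fps (\<lambda>n. \<phi> (int n) t)"
  \<comment> \<open>\<open>V\<close> inverts the same series as \<open>E\<close>, so the two will
    coincide; the four monomials arise from multiplying out \<open>(1 - P) * R\<close>.\<close>
  have "V * D = 1"
  proof -
    have D: "D = 1 - fps_X - fps_const (a * y) * fps_X ^ l - fps_const (- (a * y * q ^ m1)) * fps_X ^ (l + m1)
       - fps_const (- (a * y * p ^ m2)) * fps_X ^ (l + m2)
       - fps_const (a * y * q ^ m1 * p ^ m2) * fps_X ^ (l + m1 + m2)"
    proof -
      have k: "Suc k1 = l1 + m1" "Suc k2 = l2 + m2" using le m1 m2 by auto
      show ?thesis
        unfolding D_def Z_def RP unfolding k a l P_def Q_def
        by (simp add: power_mult_distrib power_add algebra_simps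
            flip: fps_const_mult fps_const_neg)
    qed
    have V: "V = Abs_fps (sol_sum l (l + m1) (l + m2) (l + m1 + m2) (a * y) (- (a * y * q ^ m1))
        (- (a * y * p ^ m2)) (a * y * q ^ m1 * p ^ m2))"
      unfolding V_def \<phi>_def y_def using le l by (simp add: varphi_eq_sol_sum)
    show ?thesis
      unfolding V D using le l by (intro fps_sol_sum) auto
  qed
  with \<open>E * D = 1\<close> have EV: "E = V"
    by (metis mult.commute mult.left_commute mult.right_neutral)
  \<comment> \<open>The two sums of claim (i) come from \<open>Q ^ l1\<close> and
    \<open>Q ^ Suc k1\<close>; their index is the total exponent of the variable.\<close>
  have R: "R = fps_const a * ((\<Sum>i = l..l + m2 - 1. fps_const (p ^ (i - l)) * fps_X ^ i)
       - fps_const ((q / p) ^ m1) * (\<Sum>i = l + m1..l + m1 + m2 - 1. fps_const (p ^ (i - l)) * fps_X ^ i))"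
  proof -
    have "fps_const a * (\<Sum>i = l..l + m2 - 1. fps_const (p ^ (i - l)) * fps_X ^ i) = Q ^ l1 * SI"
    proof -
      have "(\<Sum>i = l..l + m2 - 1. fps_const (p ^ (i - l)) * fps_X ^ i) =
          (\<Sum>i = l2..k2. fps_const (p ^ (i - l2)) * fps_X ^ (i + l1))"
        by (rule sum.reindex_bij_witness[where i = "\<lambda>i. i + l1" and j = "\<lambda>i. i - l1"])
           (use l m2 le in auto)
      moreover have "fps_const a * (fps_const (p ^ (i - l2)) * fps_X ^ (i + l1)) = Q ^ l1 * P ^ i"
        if "i \<in> {l2..k2}" for i
      proof -
        have "p ^ i = p ^ l2 * p ^ (i - l2)" using that by (simp flip: power_add)
        then have "P ^ i = fps_const (p ^ l2) * fps_const (p ^ (i - l2)) * fps_X ^ i"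
          by (simp add: P_def power_mult_distrib)
        then show ?thesis
          by (simp add: a Q_def power_mult_distrib power_add mult_ac flip: fps_const_mult)
      qed
      ultimately show ?thesis by (simp add: SI_def sum_distrib_left)
    qed
    moreover have "fps_const a * (fps_const ((q / p) ^ m1) *
        (\<Sum>i = l + m1..l + m1 + m2 - 1. fps_const (p ^ (i - l)) * fps_X ^ i)) = Q ^ Suc k1 * SI"
    proof -
      have k: "Suc k1 = l1 + m1" using le m1 by auto
      have "(\<Sum>i = l + m1..l + m1 + m2 - 1. fps_const (p ^ (i - l)) * fps_X ^ i) =
          (\<Sum>i = l2..k2. fps_const (p ^ (i - l2 + m1)) * fps_X ^ (i + Suc k1))"
        by (rule sum.reindex_bij_witness[where i = "\<lambda>i. i + l1 + m1" and j = "\<lambda>i. i - l1 - m1"])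
           (use l m2 le k in auto)
      moreover have "fps_const a * (fps_const ((q / p) ^ m1) * (fps_const (p ^ (i - l2 + m1)) * fps_X ^ (i + Suc k1)))
          = Q ^ Suc k1 * P ^ i" if "i \<in> {l2..k2}" for i
      proof -
        have "p ^ i = p ^ l2 * p ^ (i - l2)" using that by (simp flip: power_add)
        \<comment> \<open>The exponent of \<open>p\<close> carries an extra \<open>m1\<close> here,
          and \<open>p > 0\<close> lets it cancel the denominator of
          \<open>(q / p) ^ m1\<close>.\<close>
        then have "a * ((q / p) ^ m1 * p ^ (i - l2 + m1)) = q ^ Suc k1 * p ^ i"
          unfolding a k using p by (simp add: power_add power_divide)
        then have "fps_const a * (fps_const ((q / p) ^ m1) * (fps_const (p ^ (i - l2 + m1)) * fps_X ^ (i + Suc k1))) =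
            fps_const (q ^ Suc k1 * p ^ i) * (fps_X ^ i * fps_X ^ Suc k1)"
          by (simp only: mult.assoc[symmetric] fps_const_mult power_add)
        also have "\<dots> = Q ^ Suc k1 * P ^ i"
          unfolding Q_def P_def power_mult_distrib fps_const_power fps_const_mult[symmetric] by (simp only: mult_ac)
        finally show ?thesis .
      qed
      ultimately show ?thesis by (simp add: SI_def sum_distrib_left del: power_Suc)
    qed
    ultimately show ?thesis by (simp add: R_def algebra_simps)
  qed
  \<comment> \<open>For \<open>i > n\<close> the coefficient is 0, in agreement with
    \<open>varphi\<close> being 0 at negative arguments.\<close>
  have shift: "fps_nth (fps_const c * fps_X ^ i * V) n = c * \<phi> (int n - int i) t" for c i
    by (simp add: mult.assoc fps_X_power_mult_nth V_def of_nat_diff) (simp add: \<phi>_def varphi_def)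
  have "F = V - fps_const (a * y) * ((\<Sum>i = l..l + m2 - 1. fps_const (p ^ (i - l)) * fps_X ^ i * V)
       - fps_const ((q / p) ^ m1) * (\<Sum>i = l + m1..l + m1 + m2 - 1. fps_const (p ^ (i - l)) * fps_X ^ i * V))"
    using E unfolding EV R
    by (simp add: algebra_simps sum_distrib_right sum_distrib_left flip: fps_const_mult)
  then have "fps_nth F n = fps_nth V n - a * y * ((\<Sum>i = l..l + m2 - 1. p ^ (i - l) * \<phi> (int n - int i) t)
       - (q / p) ^ m1 * (\<Sum>i = l + m1..l + m1 + m2 - 1. p ^ (i - l) * \<phi> (int n - int i) t))"
    by (simp add: fps_sum_nth shift)
  then show ?thesis by (simp add: F_def V_def y_def)
qed

section \<open>Coefficients in \<open>t\<close> and claim (ii) for means over words\<close>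

lemma mean_cong:
  "(\<And>w. length w = n \<Longrightarrow> f w = g w) \<Longrightarrow> mean p n f = mean p n g"
proof (induction n arbitrary: f g)
  case (Suc n)
  have "mean p n (\<lambda>w. f (b # w)) = mean p n (\<lambda>w. g (b # w))" for b
    by (rule Suc.IH) (simp add: Suc.prems)
  then show ?case by (simp only: mean.simps)
qed simp

text \<open>Each letter adds at most one pattern. This bounds the degree in \<open>t\<close> of the
  generating function by the number of trials.\<close>

lemma count_patterns_le_length:
  assumes "\<And>j. j \<in> J \<Longrightarrow> 1 \<le> j"
  shows "count_patterns J I w \<le> length w"
proof (induction w)
  case (Cons b w)
  then show ?case using new_patterns_le_1[OF assms, of J I w] by auto
qed simp

lemma mean_power_count_eq_sum:
  assumes "\<And>j. j \<in> J \<Longrightarrow> 1 \<le> j" "n \<le> N"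
  shows "mean p n (\<lambda>w. t ^ count_patterns J I w) =
    (\<Sum>m\<le>N. mean p n (\<lambda>w. of_bool (count_patterns J I w = m)) * t ^ m)"
proof -
  have "mean p n (\<lambda>w. t ^ count_patterns J I w) =
      mean p n (\<lambda>w. \<Sum>m\<le>N. t ^ m * of_bool (count_patterns J I w = m))"
  proof (rule mean_cong)
    fix w :: "nat list" assume "length w = n"
    then have "count_patterns J I w \<le> N"
      using count_patterns_le_length[OF assms(1), of J I w] assms(2) by simp
    then have "{..N} \<inter> {m. count_patterns J I w = m} = {count_patterns J I w}" by auto
    then show "t ^ count_patterns J I w = (\<Sum>m\<le>N. t ^ m * of_bool (count_patterns J I w = m))"
      by simp
  qed
  then show ?thesis by (simp only: mean_sum[OF finite_atMost] mean_cmult mult.commute[of _ "t ^ _"])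
qed

text \<open>Claim (i) holds for every real \<open>t\<close>, so both sides agree as polynomials in
  \<open>t\<close>, and the coefficients of \<open>t^m\<close> give the formula.\<close>

lemma mean_count_eq_formula:
  fixes p q a :: real
  assumes p: "0 < p" and q: "q = 1 - p"
    and le: "1 \<le> l1" "l1 \<le> k1" "1 \<le> l2" "l2 \<le> k2"
    and a: "a = q ^ l1 * p ^ l2" and l: "l = l1 + l2" and m1: "m1 = k1 - l1 + 1" and m2: "m2 = k2 - l2 + 1"
  defines "\<kappa> \<equiv> kappa l m1 m2 p q a"
  shows "mean p n (\<lambda>w. of_bool (count_patterns {l1..k1} {l2..k2} w = m)) =
    \<kappa> (int m) (int n) - a *
      ((\<Sum>i = l..l + m2 - 1. p ^ (i - l) * (\<kappa> (int m - 1) (int n - int i) - \<kappa> (int m) (int n - int i)))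
       - (q / p) ^ m1 * (\<Sum>i = l + m1..l + m1 + m2 - 1.
            p ^ (i - l) * (\<kappa> (int m - 1) (int n - int i) - \<kappa> (int m) (int n - int i))))"
proof -
  \<comment> \<open>At least \<open>n\<close>, so that the expansions in \<open>t\<close> are
    complete, and at least \<open>m\<close>, so that the coefficient of \<open>t^m\<close> lies in
    the range.\<close>
  define N where "N = n + m"
  define pr where "pr k = mean p n (\<lambda>w. of_bool (count_patterns {l1..k1} {l2..k2} w = k))" for k
  define K where "K i = (\<Sum>k\<le>N. monom (\<kappa> (int k) (int n - int i)) k)" for i
  \<comment> \<open>The factor is \<open>t - 1\<close>, which produces the differences of
    \<open>kappa\<close> at \<open>m - 1\<close> and \<open>m\<close>.\<close>
  define L where "L i = [:-1, 1:] * K i" for i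
  have polyK: "poly (K i) t = varphi l m1 m2 p q a (int n - int i) t" for i t
  proof (cases "i \<le> n")
    case True
    have "varphi l m1 m2 p q a (int (n - i)) t = (\<Sum>k\<le>N. \<kappa> (int k) (int (n - i)) * t ^ k)"
      unfolding \<kappa>_def using le l by (intro varphi_eq_sum_kappa) (auto simp: N_def)
    then show ?thesis using True by (simp add: K_def poly_sum poly_monom)
  next
    case False
    then show ?thesis by (simp add: K_def \<kappa>_def kappa_def varphi_def)
  qed
  have "(\<Sum>k\<le>N. monom (pr k) k) =
      K 0 - smult a ((\<Sum>i = l..l + m2 - 1. smult (p ^ (i - l)) (L i))
        - smult ((q / p) ^ m1) (\<Sum>i = l + m1..l + m1 + m2 - 1. smult (p ^ (i - l)) (L i)))"
    (is "?A = ?B")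
  proof -
    have "poly ?A t = poly ?B t" for t
    proof -
      have "poly ?A t = mean p n (\<lambda>w. t ^ count_patterns {l1..k1} {l2..k2} w)"
        using mean_power_count_eq_sum[of "{l1..k1}" n N p t] le
        by (simp add: poly_sum poly_monom pr_def N_def)
      moreover have "poly (L i) t = (t - 1) * varphi l m1 m2 p q a (int n - int i) t" for i
        by (simp only: L_def poly_mult polyK) simp
      moreover have "(\<Sum>i\<in>A. p ^ (i - l) * ((t - 1) * f i)) = (t - 1) * (\<Sum>i\<in>A. p ^ (i - l) * f i)" for A f
        by (simp only: sum_distrib_left mult.left_commute)
      ultimately show ?thesis
        unfolding mean_power_count_formula[OF assms(1-10)]
        by (simp only: poly_diff poly_smult poly_sum polyK) (simp add: algebra_simps)
    qed
    then show ?thesis by (intro poly_eq_poly_eq_iff[THEN iffD1] ext)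
  qed
  then have "coeff ?A m = coeff ?B m" by simp
  moreover have coeffK: "coeff (K i) k = \<kappa> (int k) (int n - int i)" if "k \<le> m" for i k
    using that by (simp add: K_def coeff_sum N_def)
  \<comment> \<open>For \<open>m = 0\<close> the first term is \<open>kappa\<close> at -1, which is
    0 by convention.\<close>
  have "coeff (L i) m = \<kappa> (int m - 1) (int n - int i) - \<kappa> (int m) (int n - int i)" for i
    using coeffK[of m i] coeffK[of "m - 1" i]
    by (cases m) (simp_all add: L_def \<kappa>_def kappa_def)
  moreover have "coeff ?A m = pr m" by (simp add: coeff_sum N_def)
  ultimately show ?thesis by (simp add: coeff_sum coeffK pr_def)
qed

section \<open>Transfer of both claims to the probability space of the trials\<close>

theorem theorem2p8:
  fixes M :: "'a measure" and \<zeta> :: "nat \<Rightarrow> 'a \<Rightarrow> nat"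
    and p q a :: real and l1 k1 l2 k2 l m1 m2 n :: nat
    and H :: "'a \<Rightarrow> nat" and \<phi> :: "int \<Rightarrow> real \<Rightarrow> real" and \<kappa> :: "int \<Rightarrow> int \<Rightarrow> real"
  assumes "prob_space M"
    and "prob_space.indep_vars M (\<lambda>_. count_space UNIV) \<zeta> {1..}"
    and "\<And>i. i \<ge> 1 \<Longrightarrow> measure M {\<omega> \<in> space M. \<zeta> i \<omega> = 1} = p"
    and "\<And>i. i \<ge> 1 \<Longrightarrow> measure M {\<omega> \<in> space M. \<zeta> i \<omega> = 0} = q"
    and "0 < p" "p \<le> 1" "q = 1 - p"
    and "1 \<le> l1" "l1 \<le> k1" "1 \<le> l2" "l2 \<le> k2"
    and "a = q ^ l1 * p ^ l2" "l = l1 + l2" "m1 = k1 - l1 + 1" "m2 = k2 - l2 + 1"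
    and "\<phi> = varphi l m1 m2 p q a"
    and "\<kappa> = kappa l m1 m2 p q a"
    and "H = (\<lambda>\<omega>. num_patterns l1 k1 l2 k2 (\<lambda>i. \<zeta> i \<omega>) n)"
    and "n \<ge> l + 1"
  shows "(\<forall>t::real. prob_space.expectation M (\<lambda>\<omega>. t ^ H \<omega>) =
            \<phi> n t - a * (t - 1) *
              ((\<Sum>i = l..l + m2 - 1. p ^ (i - l) * \<phi> (int n - int i) t)
               - (q / p) ^ m1 * (\<Sum>i = l + m1..l + m1 + m2 - 1. p ^ (i - l) * \<phi> (int n - int i) t)))
       \<and> (\<forall>m::nat. measure M {\<omega> \<in> space M. H \<omega> = m} =
            \<kappa> m n - a *
              ((\<Sum>i = l..l + m2 - 1.
                  p ^ (i - l) * (\<kappa> (int m - 1) (int n - int i) - \<kappa> m (int n - int i)))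
               - (q / p) ^ m1 * (\<Sum>i = l + m1..l + m1 + m2 - 1.
                  p ^ (i - l) * (\<kappa> (int m - 1) (int n - int i) - \<kappa> m (int n - int i)))))"
proof -
  interpret prob_space M by fact
  let ?c = "count_patterns {l1..k1} {l2..k2}"
  have H: "H \<omega> = ?c (history (\<lambda>i. \<zeta> i \<omega>) n)" for \<omega>
    using assms by (simp add: num_patterns_eq_count_patterns)
  \<comment> \<open>One transfer serves both claims: \<open>g\<close> is a power of \<open>t\<close>
    for (i) and the indicator of a value for (ii).\<close>
  have E: "expectation (\<lambda>\<omega>. g (H \<omega>)) = mean p n (\<lambda>w. g (?c w))" for g
    unfolding H using assms by (intro expectation_history[where g = "\<lambda>w. g (?c w)"]) auto
  have "expectation (\<lambda>\<omega>. t ^ H \<omega>) =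
            \<phi> n t - a * (t - 1) *
              ((\<Sum>i = l..l + m2 - 1. p ^ (i - l) * \<phi> (int n - int i) t)
               - (q / p) ^ m1 * (\<Sum>i = l + m1..l + m1 + m2 - 1. p ^ (i - l) * \<phi> (int n - int i) t))" for t
    unfolding E \<open>\<phi> = _\<close> by (rule mean_power_count_formula) fact+
  moreover have "prob {\<omega> \<in> space M. H \<omega> = m} =
            \<kappa> m n - a *
              ((\<Sum>i = l..l + m2 - 1.
                  p ^ (i - l) * (\<kappa> (int m - 1) (int n - int i) - \<kappa> m (int n - int i)))
               - (q / p) ^ m1 * (\<Sum>i = l + m1..l + m1 + m2 - 1.
                  p ^ (i - l) * (\<kappa> (int m - 1) (int n - int i) - \<kappa> m (int n - int i))))" for m
  proof -
    have "prob {\<omega> \<in> space M. H \<omega> = m} = expectation (indicator {\<omega> \<in> space M. H \<omega> = m})"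
      by (simp, rule arg_cong[where f = prob], auto)
    also have "\<dots> = expectation (\<lambda>\<omega>. of_bool (H \<omega> = m))"
      by (rule Bochner_Integration.integral_cong) auto
    also have "\<dots> = mean p n (\<lambda>w. of_bool (?c w = m))" by (rule E)
    finally have eq: "prob {\<omega> \<in> space M. H \<omega> = m} = mean p n (\<lambda>w. of_bool (?c w = m))" .
    show ?thesis
      unfolding eq \<open>\<kappa> = _\<close> by (rule mean_count_eq_formula) fact+
  qed
  ultimately show ?thesis by blast
qed

end
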